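(* Let $\mathbf P=(P,\leq,{}',0,1)$ be an orthomodular poset of finite height and define mappings $\odot,\rightarrow\colon P^2\rightarrow 2^P\setminus\{\emptyset\}$ by $$x\odot y:=\operatorname{Min}U(x,y')\wedge y,\qquad x\rightarrow y:=x'\vee\operatorname{Max}L(x,y)$$ for all $x,y\in P$. Then $\mathbb R(\mathbf P):=(P,\leq,\odot,\rightarrow,0,1)$ is an idempotent and divisible operator residuated structure satisfying both the double negation law and the contraposition law, and $x\rightarrow 0=x'$ for all $x\in P$.
   Context: Orthomodular poset: a bounded poset $(P,\leq,{}',0,1)$ with a unary operation $'$ that is an antitone involution ($x\le y$ implies $y'\le x'$; $x''=x$) and a complementation ($x\vee x'=1$ and $x\wedge x'=0$ for all $x$), such that: if $x\leq y'$ then the join $x\vee y$ exists; and if $x\leq y$ then $y=x\vee(y'\vee x)'$. A poset is of finite height if it contains no infinite chain. Set notation in a poset $(P,\le)$: for $A,B\subseteq P$, $A\leq B$ means $x\leq y$ for all $x\in A$, $y\in B$; $L(A)=\{x\in P\mid x\leq a\text{ for all }a\in A\}$, $U(A)=\{x\in P\mid a\leq x\text{ for all }a\in A\}$, $L(a,b)=L(\{a,b\})$, $U(a,b)=U(\{a,b\})$. $\operatorname{Min}A$ and $\operatorname{Max}A$ are the sets of minimal and maximal elements of $A$. Lattice operations on sets are elementwise: $A\wedge y=\{a\wedge y\mid a\in A\}$, $x\vee A=\{x\vee a\mid a\in A\}$, etc. (such an expression is defined if all the meets or joins involved exist). Elements $x$ are identified with singletons $\{x\}$. For non-empty $A,B\subseteq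 P$: $A\sqsubseteq B$ iff there are $a\in A$ and $b\in B$ with $a\leq b$. For a mapping $\otimes\colon P^2\to 2^P$, $A\subseteq P$ and $y\in P$ put $A\otimes y:=\bigcup_{x\in A}(x\otimes y)$. An operator residuated structure is a six-tuple $(P,\leq,\odot,\rightarrow,0,1)$ such that for all $x,y,z\in P$: (i) $(P,\leq,0,1)$ is a bounded poset; (ii) $\odot$ and $\rightarrow$ are mappings from $P^2$ to $2^P\setminus\{\emptyset\}$; (iii) $x\odot y\sqsubseteq z$ if and only if $x\sqsubseteq y\rightarrow z$; (iv) $x\odot 1=1\odot x=x$; (v) $y\rightarrow 0\leq x$ implies $x\odot y=x\wedge y$ (in particular the meet exists); (vi) $y\leq x$ implies $x\rightarrow y=(x\rightarrow 0)\vee y$ (in particular the joins exist). It is idempotent if $x\odot x=x$ for all $x$; divisible if $(x\rightarrow y)\odot x=\operatorname{Max}L(x,y)$ for all $x,y$; it satisfies the double negation law if $(x\rightarrow 0)\rightarrow 0=x$ for all $x$; it satisfies the contraposition law if $x\leq y$ implies $y\rightarrow 0\leq x\rightarrow 0$. *)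

theory Defs
  imports "HOL-Algebra.Lattice"
begin

text \<open>
  Posets are \<open>partial_order\<close> structures of HOL-Algebra (carrier, \<open>\<sqsubseteq>\<close>, and the equality \<open>=\<close>);
  \<open>L(A)\<close> and \<open>U(A)\<close> are \<^const>\<open>Lower\<close> and \<^const>\<open>Upper\<close>. The library operations \<open>\<sqinter>\<close>, \<open>\<squnion>\<close>
  are total (chosen by \<open>SOME\<close>), so existence of the meets and joins used is always
  stated separately by the following two predicates.
\<close>

definition has_meet :: "('a, 'b) gorder_scheme \<Rightarrow> 'a \<Rightarrow> 'a \<Rightarrow> bool"
  where "has_meet L x y \<longleftrightarrow> (\<exists>m. is_glb L m {x, y})"

definition has_join :: "('a, 'b) gorder_scheme \<Rightarrow> 'a \<Rightarrow> 'a \<Rightarrow> bool"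
  where "has_join L x y \<longleftrightarrow> (\<exists>j. is_lub L j {x, y})"

definition set_meet_defined :: "('a, 'b) gorder_scheme \<Rightarrow> 'a set \<Rightarrow> 'a \<Rightarrow> bool"
  where "set_meet_defined L A y \<longleftrightarrow> (\<forall>a\<in>A. has_meet L a y)"

definition set_meet :: "('a, 'b) gorder_scheme \<Rightarrow> 'a set \<Rightarrow> 'a \<Rightarrow> 'a set"
  where "set_meet L A y = {a \<sqinter>\<^bsub>L\<^esub> y | a. a \<in> A}"

definition set_join_defined :: "('a, 'b) gorder_scheme \<Rightarrow> 'a \<Rightarrow> 'a set \<Rightarrow> bool"
  where "set_join_defined L x A \<longleftrightarrow> (\<forall>a\<in>A. has_join L x a)"

definition set_join :: "('a, 'b) gorder_scheme \<Rightarrow> 'a \<Rightarrow> 'a set \<Rightarrow> 'a set"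
  where "set_join L x A = {x \<squnion>\<^bsub>L\<^esub> a | a. a \<in> A}"

definition Min_elts :: "('a, 'b) gorder_scheme \<Rightarrow> 'a set \<Rightarrow> 'a set"
  where "Min_elts L A = {m \<in> A. \<forall>a\<in>A. a \<sqsubseteq>\<^bsub>L\<^esub> m \<longrightarrow> a = m}"

definition Max_elts :: "('a, 'b) gorder_scheme \<Rightarrow> 'a set \<Rightarrow> 'a set"
  where "Max_elts L A = {m \<in> A. \<forall>a\<in>A. m \<sqsubseteq>\<^bsub>L\<^esub> a \<longrightarrow> a = m}"

definition set_le :: "('a, 'b) gorder_scheme \<Rightarrow> 'a set \<Rightarrow> 'a set \<Rightarrow> bool"
  where "set_le L A B \<longleftrightarrow> (\<forall>a\<in>A. \<forall>b\<in>B. a \<sqsubseteq>\<^bsub>L\<^esub> b)"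

text \<open>The relation written \<open>A \<sqsubseteq> B\<close> between non-empty subsets:\<close>

definition set_below :: "('a, 'b) gorder_scheme \<Rightarrow> 'a set \<Rightarrow> 'a set \<Rightarrow> bool"
  where "set_below L A B \<longleftrightarrow> (\<exists>a\<in>A. \<exists>b\<in>B. a \<sqsubseteq>\<^bsub>L\<^esub> b)"

definition op_ext :: "('a \<Rightarrow> 'a \<Rightarrow> 'a set) \<Rightarrow> 'a set \<Rightarrow> 'a \<Rightarrow> 'a set"
  where "op_ext f A y = (\<Union>x\<in>A. f x y)"

definition finite_height :: "('a, 'b) gorder_scheme \<Rightarrow> bool"
  where "finite_height L \<longleftrightarrow>
    (\<forall>C \<subseteq> carrier L. (\<forall>x\<in>C. \<forall>y\<in>C. x \<sqsubseteq>\<^bsub>L\<^esub> y \<or> y \<sqsubseteq>\<^bsub>L\<^esub> x) \<longrightarrow> finite C)"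

locale bounded_partial_order =
  partial_order L + weak_partial_order_bottom L + weak_partial_order_top L
  for L (structure)

text \<open>
  In \<open>orthomodular\<close> both joins exist by \<open>orthogonal_join\<close>: \<open>x \<sqsubseteq> y = (y')'\<close> yields \<open>y' \<squnion> x\<close>,
  and \<open>x \<sqsubseteq> y' \<squnion> x = ((y' \<squnion> x)')'\<close> yields the outer one.
\<close>

locale orthomodular_poset = bounded_partial_order L for L (structure) +
  fixes compl :: "'a \<Rightarrow> 'a"
  assumes compl_closed: "x \<in> carrier L \<Longrightarrow> compl x \<in> carrier L"
    and compl_antitone:
      "\<lbrakk>x \<in> carrier L; y \<in> carrier L; x \<sqsubseteq> y\<rbrakk> \<Longrightarrow> compl y \<sqsubseteq> compl x"
    and compl_involution: "x \<in> carrier L \<Longrightarrow> compl (compl x) = x"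
    and compl_join: "x \<in> carrier L \<Longrightarrow> is_lub L \<top> {x, compl x}"
    and compl_meet: "x \<in> carrier L \<Longrightarrow> is_glb L \<bottom> {x, compl x}"
    and orthogonal_join:
      "\<lbrakk>x \<in> carrier L; y \<in> carrier L; x \<sqsubseteq> compl y\<rbrakk> \<Longrightarrow> has_join L x y"
    and orthomodular:
      "\<lbrakk>x \<in> carrier L; y \<in> carrier L; x \<sqsubseteq> y\<rbrakk> \<Longrightarrow> y = x \<squnion> compl (compl y \<squnion> x)"

text \<open>
  The constants \<open>0\<close> and \<open>1\<close> of the six-tuple are \<open>\<bottom>\<close> and \<open>\<top>\<close>, which the order determines.
  Where an element occurs in place of a set, it is the singleton. In \<open>imp_above\<close> the
  join \<open>(x \<rightarrow> 0) \<or> y\<close> of a set with an element is written with the element on the left.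
\<close>

locale operator_residuated_structure = bounded_partial_order L for L (structure) +
  fixes odot :: "'a \<Rightarrow> 'a \<Rightarrow> 'a set"
    and imp :: "'a \<Rightarrow> 'a \<Rightarrow> 'a set"
  assumes odot_closed:
      "\<lbrakk>x \<in> carrier L; y \<in> carrier L\<rbrakk> \<Longrightarrow> odot x y \<in> Pow (carrier L) - {{}}"
    and imp_closed:
      "\<lbrakk>x \<in> carrier L; y \<in> carrier L\<rbrakk> \<Longrightarrow> imp x y \<in> Pow (carrier L) - {{}}"
    and adjoint:
      "\<lbrakk>x \<in> carrier L; y \<in> carrier L; z \<in> carrier L\<rbrakk> \<Longrightarrow>
        set_below L (odot x y) {z} \<longleftrightarrow> set_below L {x} (imp y z)"
    and odot_top_right: "x \<in> carrier L \<Longrightarrow> odot x \<top> = {x}"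
    and odot_top_left: "x \<in> carrier L \<Longrightarrow> odot \<top> x = {x}"
    and odot_meet:
      "\<lbrakk>x \<in> carrier L; y \<in> carrier L; set_le L (imp y \<bottom>) {x}\<rbrakk> \<Longrightarrow>
        has_meet L x y \<and> odot x y = {x \<sqinter> y}"
    and imp_above:
      "\<lbrakk>x \<in> carrier L; y \<in> carrier L; y \<sqsubseteq> x\<rbrakk> \<Longrightarrow>
        set_join_defined L y (imp x \<bottom>) \<and> imp x y = set_join L y (imp x \<bottom>)"

definition ors_idempotent :: "('a, 'b) gorder_scheme \<Rightarrow> ('a \<Rightarrow> 'a \<Rightarrow> 'a set) \<Rightarrow> bool"
  where "ors_idempotent L odot \<longleftrightarrow> (\<forall>x\<in>carrier L. odot x x = {x})"

definition ors_divisible ::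
    "('a, 'b) gorder_scheme \<Rightarrow> ('a \<Rightarrow> 'a \<Rightarrow> 'a set) \<Rightarrow> ('a \<Rightarrow> 'a \<Rightarrow> 'a set) \<Rightarrow> bool"
  where "ors_divisible L odot imp \<longleftrightarrow>
    (\<forall>x\<in>carrier L. \<forall>y\<in>carrier L. op_ext odot (imp x y) x = Max_elts L (Lower L {x, y}))"

definition double_negation_law :: "('a, 'b) gorder_scheme \<Rightarrow> ('a \<Rightarrow> 'a \<Rightarrow> 'a set) \<Rightarrow> bool"
  where "double_negation_law L imp \<longleftrightarrow>
    (\<forall>x\<in>carrier L. op_ext imp (imp x \<bottom>\<^bsub>L\<^esub>) \<bottom>\<^bsub>L\<^esub> = {x})"

definition contraposition_law :: "('a, 'b) gorder_scheme \<Rightarrow> ('a \<Rightarrow> 'a \<Rightarrow> 'a set) \<Rightarrow> bool"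
  where "contraposition_law L imp \<longleftrightarrow>
    (\<forall>x\<in>carrier L. \<forall>y\<in>carrier L.
      x \<sqsubseteq>\<^bsub>L\<^esub> y \<longrightarrow> set_le L (imp y \<bottom>\<^bsub>L\<^esub>) (imp x \<bottom>\<^bsub>L\<^esub>))"

definition omp_odot :: "('a, 'b) gorder_scheme \<Rightarrow> ('a \<Rightarrow> 'a) \<Rightarrow> 'a \<Rightarrow> 'a \<Rightarrow> 'a set"
  where "omp_odot L compl x y = set_meet L (Min_elts L (Upper L {x, compl y})) y"

definition omp_imp :: "('a, 'b) gorder_scheme \<Rightarrow> ('a \<Rightarrow> 'a) \<Rightarrow> 'a \<Rightarrow> 'a \<Rightarrow> 'a set"
  where "omp_imp L compl x y = set_join L (compl x) (Max_elts L (Lower L {x, y}))"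

end

theory Submission
  imports Defs
begin

text \<open>
  Finite height provides minimal elements of \<open>U(x, y')\<close> and maximal elements of \<open>L(x, y)\<close>.
  For \<open>w \<ge> y'\<close> and \<open>m \<le> y\<close>, orthomodularity says \<open>y' \<or> (w \<and> y) = w\<close> and
  \<open>(y' \<or> m) \<and> y = m\<close>, so \<open>w \<mapsto> w \<and> y\<close> and \<open>m \<mapsto> y' \<or> m\<close> are mutually inverse isomorphisms
  between the intervals \<open>[y', 1]\<close> and \<open>[0, y]\<close>. Adjointness and divisibility follow.
\<close>

section \<open>Bounds of pairs and extremal elements in a partial order\<close>

lemma (in partial_order) is_lub_pair_iff:
  assumes "x \<in> carrier L" "y \<in> carrier L"
  shows "is_lub L s {x, y} \<longleftrightarrow>
    s \<in> carrier L \<and> x \<sqsubseteq> s \<and> y \<sqsubseteq> s \<and> (\<forall>z\<in>carrier L. x \<sqsubseteq> z \<longrightarrow> y \<sqsubseteq> z \<longrightarrow> s \<sqsubseteq> z)"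
  using assms by (auto simp: least_def Upper_def)

lemma (in partial_order) is_glb_pair_iff:
  assumes "x \<in> carrier L" "y \<in> carrier L"
  shows "is_glb L s {x, y} \<longleftrightarrow>
    s \<in> carrier L \<and> s \<sqsubseteq> x \<and> s \<sqsubseteq> y \<and> (\<forall>z\<in>carrier L. z \<sqsubseteq> x \<longrightarrow> z \<sqsubseteq> y \<longrightarrow> z \<sqsubseteq> s)"
  using assms by (auto simp: greatest_def Lower_def)

text \<open>The total join is chosen by \<open>SOME\<close>; uniqueness of least elements identifies
  the choice with any supremum already known.\<close>

lemma (in partial_order) join_eqI: "is_lub L s {x, y} \<Longrightarrow> x \<squnion> y = s"
  unfolding join_def sup_def by (blast intro: least_unique)

lemma (in partial_order) meet_eqI: "is_glb L s {x, y} \<Longrightarrow> x \<sqinter> y = s"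
  unfolding meet_def inf_def by (blast intro: greatest_unique)

lemma (in partial_order) has_join_is_lub: "has_join L x y \<Longrightarrow> is_lub L (x \<squnion> y) {x, y}"
  unfolding has_join_def using join_eqI by blast

text \<open>Zorn's lemma is applied to the part of \<open>A\<close> above \<open>a\<close>. Finite
  height makes every chain there finite, and a finite non-empty chain is bounded by its own greatest
  element. By transitivity, an element maximal in this part is maximal in all of
  \<open>A\<close>.\<close>

lemma (in partial_order) ex_Max_elts_above:
  assumes fh: "finite_height L" and A: "A \<subseteq> carrier L" and a: "a \<in> A"
  shows "\<exists>m\<in>Max_elts L A. a \<sqsubseteq> m"
proof -
  let ?B = "{b \<in> A. a \<sqsubseteq> b}"
  have B: "b \<in> carrier L" if "b \<in> ?B" for b using that A by blast
  have "\<exists>m\<in>?B. \<forall>b\<in>?B. m \<sqsubseteq> b \<longrightarrow> b = m"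
  proof (rule predicate_Zorn)
    show "partial_order_on ?B (relation_of (\<sqsubseteq>) ?B)"
    proof (rule partial_order_on_relation_ofI)
      show "x \<sqsubseteq> x" if "x \<in> ?B" for x
        using B[OF that] by (rule le_refl)
      show "x \<sqsubseteq> z" if "x \<in> ?B" "y \<in> ?B" "z \<in> ?B" "x \<sqsubseteq> y" "y \<sqsubseteq> z" for x y z
        using that(4,5) B[OF that(1)] B[OF that(2)] B[OF that(3)] by (rule le_trans)
      show "x = y" if "x \<in> ?B" "y \<in> ?B" "x \<sqsubseteq> y" "y \<sqsubseteq> x" for x y
        using that(3,4) B[OF that(1)] B[OF that(2)] by (rule le_antisym)
    qed
  next
    fix C assume "C \<in> Chains (relation_of (\<sqsubseteq>) ?B)"
    then have CB: "C \<subseteq> ?B" and chain: "\<forall>x\<in>C. \<forall>y\<in>C. x \<sqsubseteq> y \<or> y \<sqsubseteq> x"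
      by (auto simp: Chains_def relation_of_def)
    then have "finite C"
      using fh A unfolding finite_height_def by blast
    show "\<exists>u\<in>?B. \<forall>c\<in>C. c \<sqsubseteq> u"
    \<comment> \<open>The empty chain has no greatest element, so \<open>a\<close> itself serves as
      its bound.\<close>
    proof (cases "C = {}")
      case True
      moreover have "a \<in> ?B" using a A by blast
      ultimately show ?thesis by blast
    next
      case False
      have "transp_on C (\<sqsubseteq>)"
        by (rule transp_onI) (use CB B le_trans in \<open>meson subsetD\<close>)
      moreover have "totalp_on C (\<sqsubseteq>)"
        using chain by (auto simp: totalp_on_def)
      ultimately obtain u where "u \<in> C" "\<forall>c\<in>C. c \<noteq> u \<longrightarrow> c \<sqsubseteq> u"
        using Finite_Set.bex_greatest_element[OF \<open>finite C\<close> False] by blast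
      \<comment> \<open>The greatest element \<open>u\<close> is only known to dominate the members
        other than itself; reflexivity supplies the remaining case.\<close>
      moreover from this have "u \<sqsubseteq> u" using CB A by blast
      ultimately have "\<exists>u\<in>C. \<forall>c\<in>C. c \<sqsubseteq> u"
        by metis
      then show ?thesis using CB by blast
    qed
  qed
  then obtain m where m: "m \<in> ?B" "\<forall>b\<in>?B. m \<sqsubseteq> b \<longrightarrow> b = m" by blast
  have "b = m" if "b \<in> A" "m \<sqsubseteq> b" for b
    using that m B[of m] le_trans[of a m b] a A by blast
  then show ?thesis
    using m(1) by (auto simp: Max_elts_def)
qed

text \<open>Comparability is symmetric, so the dual order also has finite height, and its maximal
  elements are the minimal elements of \<open>L\<close>.\<close>

lemma (in partial_order) ex_Min_elts_below:
  assumes "finite_height L" and "A \<subseteq> carrier L" and "a \<in> A"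
  shows "\<exists>m\<in>Min_elts L A. m \<sqsubseteq> a"
proof -
  have "finite_height (inv_gorder L)"
    using assms(1) unfolding finite_height_def by (simp add: disj_commute)
  from partial_order.ex_Max_elts_above[OF dual_order this, of A a] show ?thesis
    using assms(2,3) by (simp add: Max_elts_def Min_elts_def)
qed

lemma (in partial_order) Max_elts_Lower_comparable:
  assumes "x \<in> carrier L" "y \<in> carrier L" "y \<sqsubseteq> x"
  shows "Max_elts L (Lower L {x, y}) = {y}"
  using assms by (auto simp: Max_elts_def Lower_def)

lemma (in partial_order) Min_elts_Upper_comparable:
  assumes "x \<in> carrier L" "y \<in> carrier L" "y \<sqsubseteq> x"
  shows "Min_elts L (Upper L {x, y}) = {x}"
  using assms by (auto simp: Min_elts_def Upper_def)

section \<open>Complements, orthogonal joins and the meets they induce\<close>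

context orthomodular_poset
begin

lemma compl_le_swap:
  assumes "x \<in> carrier L" "y \<in> carrier L" "compl x \<sqsubseteq> y"
  shows "compl y \<sqsubseteq> x"
  using compl_antitone[OF compl_closed[OF assms(1)] assms(2,3)] compl_involution[OF assms(1)]
  by simp

text \<open>Since m \<le> x = x'', the elements m and x' are orthogonal, so their join
  exists.\<close>

lemma is_lub_compl_join:
  assumes "x \<in> carrier L" "m \<in> carrier L" "m \<sqsubseteq> x"
  shows "is_lub L (compl x \<squnion> m) {compl x, m}"
proof -
  have "has_join L m (compl x)"
    using orthogonal_join assms compl_closed compl_involution by simp
  then show ?thesis
    using has_join_is_lub[of m "compl x"] by (simp add: join_comm insert_commute)
qed

lemma compl_join_props:
  assumes "x \<in> carrier L" "m \<in> carrier L" "m \<sqsubseteq> x"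
  shows "compl x \<squnion> m \<in> carrier L" "compl x \<sqsubseteq> compl x \<squnion> m" "m \<sqsubseteq> compl x \<squnion> m"
    "\<And>z. \<lbrakk>z \<in> carrier L; compl x \<sqsubseteq> z; m \<sqsubseteq> z\<rbrakk> \<Longrightarrow> compl x \<squnion> m \<sqsubseteq> z"
  using is_lub_compl_join[OF assms] assms by (auto simp: is_lub_pair_iff compl_closed)

text \<open>From y' \<le> w follows w' \<le> y, so y' \<or> w' is a genuine supremum. The antitone
  involution turns it into an infimum of w and y, which is how meets arise although only orthogonal
  joins are postulated.\<close>

lemma is_glb_de_Morgan:
  assumes y: "y \<in> carrier L" and w: "w \<in> carrier L" and le: "compl y \<sqsubseteq> w"
  shows "is_glb L (compl (compl y \<squnion> compl w)) {w, y}"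
proof -
  have wy: "compl w \<sqsubseteq> y" using compl_le_swap y w le by blast
  note J = compl_join_props[OF y compl_closed[OF w] wy]
  have "z \<sqsubseteq> compl (compl y \<squnion> compl w)" if z: "z \<in> carrier L" "z \<sqsubseteq> w" "z \<sqsubseteq> y" for z
  proof -
    have "compl y \<squnion> compl w \<sqsubseteq> compl z"
      using compl_antitone[OF z(1) w z(2)] compl_antitone[OF z(1) y z(3)]
      by (intro J(4) compl_closed z(1))
    then show ?thesis
      using compl_antitone[OF J(1) compl_closed[OF z(1)]] compl_involution z(1) by simp
  qed
  then show ?thesis
    using J(1) compl_le_swap[OF y J(1,2)] compl_le_swap[OF w J(1,3)] y w
    by (simp add: is_glb_pair_iff compl_closed)
qed

lemma is_glb_meet:
  assumes "y \<in> carrier L" "w \<in> carrier L" "compl y \<sqsubseteq> w"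
  shows "is_glb L (w \<sqinter> y) {w, y}"
  using is_glb_de_Morgan[OF assms] meet_eqI by metis

lemma meet_props:
  assumes "y \<in> carrier L" "w \<in> carrier L" "compl y \<sqsubseteq> w"
  shows "w \<sqinter> y \<in> carrier L" "w \<sqinter> y \<sqsubseteq> w" "w \<sqinter> y \<sqsubseteq> y"
  using is_glb_meet[OF assms] assms by (auto simp: is_glb_pair_iff)

text \<open>The orthomodular law for y' \<le> w, with (w' \<or> y')' read as w \<and> y.\<close>

lemma compl_join_meet:
  assumes y: "y \<in> carrier L" and w: "w \<in> carrier L" and le: "compl y \<sqsubseteq> w"
  shows "compl y \<squnion> (w \<sqinter> y) = w"
proof -
  have "w = compl y \<squnion> compl (compl w \<squnion> compl y)"
    by (rule orthomodular[OF compl_closed[OF y] w le])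
  also have "compl (compl w \<squnion> compl y) = w \<sqinter> y"
    using meet_eqI[OF is_glb_de_Morgan[OF assms]] by (simp add: join_comm)
  finally show ?thesis by simp
qed

text \<open>The orthomodular law for y' \<le> m' gives m' = y' \<or> (y' \<or> m)'. Complementing
  both sides and applying de Morgan with w = y' \<or> m yields the claim.\<close>

lemma compl_join_meet_cancel:
  assumes y: "y \<in> carrier L" and m: "m \<in> carrier L" and le: "m \<sqsubseteq> y"
  shows "(compl y \<squnion> m) \<sqinter> y = m"
proof -
  note J = compl_join_props[OF assms]
  have "compl y \<sqsubseteq> compl m" by (rule compl_antitone[OF m y le])
  then have "compl m = compl y \<squnion> compl (compl (compl m) \<squnion> compl y)"
    by (rule orthomodular[OF compl_closed[OF y] compl_closed[OF m]])
  also have "compl (compl m) \<squnion> compl y = compl y \<squnion> m"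
    by (simp add: compl_involution m join_comm)
  finally have "compl (compl m) = compl (compl y \<squnion> compl (compl y \<squnion> m))" by simp
  then show ?thesis
    using meet_eqI[OF is_glb_de_Morgan[OF y J(1,2)]] by (simp add: compl_involution m)
qed

lemma meet_comparable:
  assumes "y \<in> carrier L" "w \<in> carrier L" "y \<sqsubseteq> w"
  shows "w \<sqinter> y = y"
  using assms by (intro meet_eqI) (auto simp: is_glb_pair_iff)

lemma compl_bot: "compl \<bottom> = \<top>"
proof (rule le_antisym)
  \<comment> \<open>Antitonicity is applied to 0 \<le> 1', whose complement is 1'' = 1.\<close>
  show "\<top> \<sqsubseteq> compl \<bottom>"
    using compl_antitone[of "\<bottom>" "compl \<top>"] by (simp add: compl_closed compl_involution)
qed (simp_all add: compl_closed)

lemma compl_top: "compl \<top> = \<bottom>"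
  using compl_bot compl_involution[OF bottom_closed] by simp

text \<open>Here x is the least element of U(x, y'), so the product collapses to a single meet. The
  unit laws, axiom \<open>odot_meet\<close> and divisibility all use this case.\<close>

lemma omp_odot_above_compl:
  assumes "x \<in> carrier L" "y \<in> carrier L" "compl y \<sqsubseteq> x"
  shows "omp_odot L compl x y = {x \<sqinter> y}"
  using assms Min_elts_Upper_comparable[of x "compl y"]
  by (auto simp: omp_odot_def set_meet_def compl_closed)

lemma omp_imp_below:
  assumes "x \<in> carrier L" "y \<in> carrier L" "y \<sqsubseteq> x"
  shows "omp_imp L compl x y = {compl x \<squnion> y}"
  using assms Max_elts_Lower_comparable[of x y]
  by (auto simp: omp_imp_def set_join_def)

lemma omp_imp_bot:
  assumes x: "x \<in> carrier L"
  shows "omp_imp L compl x \<bottom> = {compl x}"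
proof -
  have "compl x \<squnion> \<bottom> = compl x"
    using x by (intro join_eqI) (auto simp: is_lub_pair_iff compl_closed)
  then show ?thesis using omp_imp_below[OF x bottom_closed] x by simp
qed

section \<open>Well-definedness, divisibility and residuation of the operators\<close>

lemma Min_elts_UpperD:
  assumes "x \<in> carrier L" "y \<in> carrier L" "w \<in> Min_elts L (Upper L {x, compl y})"
  shows "w \<in> carrier L" "x \<sqsubseteq> w" "compl y \<sqsubseteq> w"
  using assms by (auto simp: Min_elts_def Upper_def compl_closed)

lemma Max_elts_LowerD:
  assumes "x \<in> carrier L" "y \<in> carrier L" "m \<in> Max_elts L (Lower L {x, y})"
  shows "m \<in> carrier L" "m \<sqsubseteq> x" "m \<sqsubseteq> y"
  using assms by (auto simp: Max_elts_def Lower_def)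

lemma set_meet_defined_Min_elts:
  assumes "x \<in> carrier L" "y \<in> carrier L"
  shows "set_meet_defined L (Min_elts L (Upper L {x, compl y})) y"
  unfolding set_meet_defined_def has_meet_def
proof
  fix w assume "w \<in> Min_elts L (Upper L {x, compl y})"
  note w = Min_elts_UpperD[OF assms this]
  show "\<exists>m. is_glb L m {w, y}"
    by (rule exI, rule is_glb_meet[OF assms(2) w(1,3)])
qed

lemma set_join_defined_Max_elts:
  assumes "x \<in> carrier L" "y \<in> carrier L"
  shows "set_join_defined L (compl x) (Max_elts L (Lower L {x, y}))"
  unfolding set_join_defined_def has_join_def
proof
  fix m assume "m \<in> Max_elts L (Lower L {x, y})"
  note m = Max_elts_LowerD[OF assms this]
  show "\<exists>j. is_lub L j {compl x, m}"
    by (rule exI, rule is_lub_compl_join[OF assms(1) m(1,2)])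
qed

text \<open>Every member x' \<or> m of the residual lies above x', so its product with x is the
  single meet (x' \<or> m) \<and> x, which cancels to m.\<close>

lemma omp_divisible: "ors_divisible L (omp_odot L compl) (omp_imp L compl)"
  unfolding ors_divisible_def
proof (intro ballI)
  fix x y assume x: "x \<in> carrier L" and y: "y \<in> carrier L"
  have "omp_odot L compl (compl x \<squnion> m) x = {m}" if "m \<in> Max_elts L (Lower L {x, y})" for m
  proof -
    note m = Max_elts_LowerD[OF x y that]
    show ?thesis
      using omp_odot_above_compl compl_join_props[OF x m(1,2)] compl_join_meet_cancel m x by simp
  qed
  then show "op_ext (omp_odot L compl) (omp_imp L compl x y) x = Max_elts L (Lower L {x, y})"
    unfolding op_ext_def omp_imp_def set_join_def by auto
qed

lemma omp_adjoint:
  assumes fh: "finite_height L"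
    and x: "x \<in> carrier L" and y: "y \<in> carrier L" and z: "z \<in> carrier L"
  shows "set_below L (omp_odot L compl x y) {z} \<longleftrightarrow> set_below L {x} (omp_imp L compl y z)"
proof
  assume "set_below L (omp_odot L compl x y) {z}"
  then obtain w where wM: "w \<in> Min_elts L (Upper L {x, compl y})" and wz: "w \<sqinter> y \<sqsubseteq> z"
    by (auto simp: set_below_def omp_odot_def set_meet_def)
  note w = Min_elts_UpperD[OF x y wM]
  note wy = meet_props[OF y w(1,3)]
  \<comment> \<open>This common lower bound of y and z extends to a maximal one, m, which selects
    the member y' \<or> m of the residual.\<close>
  have l: "w \<sqinter> y \<in> Lower L {y, z}"
    using wy wz by (auto simp: Lower_def)
  obtain m where mM: "m \<in> Max_elts L (Lower L {y, z})" and wm: "w \<sqinter> y \<sqsubseteq> m"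
    using ex_Max_elts_above[OF fh Lower_closed l] by blast
  note m = Max_elts_LowerD[OF y z mM]
  note J = compl_join_props[OF y m(1,2)]
  \<comment> \<open>Recovering w from w \<and> y and enlarging w \<and> y to m gives x \<le> w \<le>
    y' \<or> m.\<close>
  have "w = compl y \<squnion> (w \<sqinter> y)" using compl_join_meet y w by simp
  also have "\<dots> \<sqsubseteq> compl y \<squnion> m"
    by (rule compl_join_props(4)[OF y wy(1,3) J(1,2) le_trans[OF wm J(3) wy(1) m(1) J(1)]])
  finally have "x \<sqsubseteq> compl y \<squnion> m"
    by (rule le_trans[OF w(2) _ x w(1) J(1)])
  then show "set_below L {x} (omp_imp L compl y z)"
    using mM by (auto simp: set_below_def omp_imp_def set_join_def)
next
  assume "set_below L {x} (omp_imp L compl y z)"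
  then obtain m where mM: "m \<in> Max_elts L (Lower L {y, z})" and xm: "x \<sqsubseteq> compl y \<squnion> m"
    by (auto simp: set_below_def omp_imp_def set_join_def)
  note m = Max_elts_LowerD[OF y z mM]
  note J = compl_join_props[OF y m(1,2)]
  \<comment> \<open>Dually, this common upper bound lies above a minimal one, w. Meeting with y then
    gives w \<and> y \<le> (y' \<or> m) \<and> y = m \<le> z.\<close>
  have u: "compl y \<squnion> m \<in> Upper L {x, compl y}"
    using J xm by (auto simp: Upper_def)
  obtain w where wM: "w \<in> Min_elts L (Upper L {x, compl y})" and wm: "w \<sqsubseteq> compl y \<squnion> m"
    using ex_Min_elts_below[OF fh Upper_closed u] by blast
  note w = Min_elts_UpperD[OF x y wM]
  note wy = meet_props[OF y w(1,3)]
  have "w \<sqinter> y \<sqsubseteq> (compl y \<squnion> m) \<sqinter> y"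
    using is_glb_meet[OF y J(1,2)] le_trans[OF wy(2) wm wy(1) w(1) J(1)] wy J y
    by (simp add: is_glb_pair_iff)
  then have "w \<sqinter> y \<sqsubseteq> m" using compl_join_meet_cancel y m by simp
  then have "w \<sqinter> y \<sqsubseteq> z" by (rule le_trans[OF _ m(3) wy(1) m(1) z])
  then show "set_below L (omp_odot L compl x y) {z}"
    using wM by (auto simp: set_below_def omp_odot_def set_meet_def)
qed

lemma omp_operator_residuated:
  assumes fh: "finite_height L"
  shows "operator_residuated_structure L (omp_odot L compl) (omp_imp L compl)"
proof unfold_locales
  fix x y assume x: "x \<in> carrier L" and y: "y \<in> carrier L"
  \<comment> \<open>The bounds 1 and 0 show that the two cones are inhabited; finite height then
    provides a minimal and a maximal element.\<close>
  have u: "\<top> \<in> Upper L {x, compl y}" using x y by (auto simp: Upper_def compl_closed)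
  have "Min_elts L (Upper L {x, compl y}) \<noteq> {}"
    using ex_Min_elts_below[OF fh Upper_closed u] by blast
  then show "omp_odot L compl x y \<in> Pow (carrier L) - {{}}"
    using meet_props(1)[OF y] Min_elts_UpperD[OF x y] by (auto simp: omp_odot_def set_meet_def)
  have l: "\<bottom> \<in> Lower L {x, y}" using x y by (auto simp: Lower_def)
  have "Max_elts L (Lower L {x, y}) \<noteq> {}"
    using ex_Max_elts_above[OF fh Lower_closed l] by blast
  then show "omp_imp L compl x y \<in> Pow (carrier L) - {{}}"
    using compl_join_props(1)[OF x] Max_elts_LowerD[OF x y]
    by (auto simp: omp_imp_def set_join_def)
next
  fix x y z assume "x \<in> carrier L" "y \<in> carrier L" "z \<in> carrier L"
  then show "set_below L (omp_odot L compl x y) {z} \<longleftrightarrow> set_below L {x} (omp_imp L compl y z)"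
    by (rule omp_adjoint[OF fh])
next
  fix x assume x: "x \<in> carrier L"
  have "x \<sqinter> \<top> = x" using meet_comparable[OF x top_closed] x by (simp add: meet_comm)
  then show "omp_odot L compl x \<top> = {x}"
    using omp_odot_above_compl[OF x top_closed] x by (simp add: compl_top)
  show "omp_odot L compl \<top> x = {x}"
    using omp_odot_above_compl[OF top_closed x] meet_comparable[OF x top_closed] x
    by (simp add: compl_closed)
next
  fix x y assume x: "x \<in> carrier L" and y: "y \<in> carrier L"
    and "set_le L (omp_imp L compl y \<bottom>) {x}"
  then have "compl y \<sqsubseteq> x" by (simp add: omp_imp_bot set_le_def)
  then show "has_meet L x y \<and> omp_odot L compl x y = {x \<sqinter> y}"
    using is_glb_meet[OF y x] omp_odot_above_compl[OF x y] unfolding has_meet_def by blast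
next
  fix x y assume x: "x \<in> carrier L" and y: "y \<in> carrier L" and le: "y \<sqsubseteq> x"
  \<comment> \<open>Orthogonality again: y \<le> x = x''.\<close>
  have "has_join L y (compl x)"
    using orthogonal_join x y le by (simp add: compl_closed compl_involution)
  then show "set_join_defined L y (omp_imp L compl x \<bottom>) \<and>
      omp_imp L compl x y = set_join L y (omp_imp L compl x \<bottom>)"
    using omp_imp_below[OF x y le]
    by (simp add: omp_imp_bot x set_join_defined_def set_join_def join_comm)
qed

text \<open>As x \<or> x' = 1, the only upper bound of x and x' is 1, and 1 \<and> x = x.\<close>

lemma omp_idempotent: "ors_idempotent L (omp_odot L compl)"
  unfolding ors_idempotent_def
proof
  fix x assume x: "x \<in> carrier L"
  have "z = \<top>" if "z \<in> Upper L {x, compl x}" for z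
  proof -
    have "z \<in> carrier L" using that Upper_closed by (rule rev_subsetD)
    then show ?thesis
      using least_le[OF compl_join[OF x] that] by (intro le_antisym) auto
  qed
  then have "Upper L {x, compl x} = {\<top>}"
    using least_mem[OF compl_join[OF x]] by blast
  then have "Min_elts L (Upper L {x, compl x}) = {\<top>}"
    by (auto simp: Min_elts_def)
  then show "omp_odot L compl x x = {x}"
    using meet_comparable[OF x top_closed] x by (simp add: omp_odot_def set_meet_def)
qed

end

theorem theorem8:
  fixes P :: "('a, 'b) gorder_scheme" and compl :: "'a \<Rightarrow> 'a"
  assumes "orthomodular_poset P compl"
    and "finite_height P"
  shows "(\<forall>x\<in>carrier P. \<forall>y\<in>carrier P.
            set_meet_defined P (Min_elts P (Upper P {x, compl y})) y \<and>
            set_join_defined P (compl x) (Max_elts P (Lower P {x, y}))) \<and>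
         operator_residuated_structure P (omp_odot P compl) (omp_imp P compl) \<and>
         ors_idempotent P (omp_odot P compl) \<and>
         ors_divisible P (omp_odot P compl) (omp_imp P compl) \<and>
         double_negation_law P (omp_imp P compl) \<and>
         contraposition_law P (omp_imp P compl) \<and>
         (\<forall>x\<in>carrier P. omp_imp P compl x \<bottom>\<^bsub>P\<^esub> = {compl x})"
proof -
  interpret orthomodular_poset P compl by (rule assms(1))
  \<comment> \<open>Because x \<rightarrow> 0 is the singleton of x', this law and the next reduce
    to the involution and antitonicity of the complement.\<close>
  have "double_negation_law P (omp_imp P compl)"
    by (simp add: double_negation_law_def op_ext_def omp_imp_bot compl_closed compl_involution)
  moreover have "contraposition_law P (omp_imp P compl)"
    by (simp add: contraposition_law_def set_le_def omp_imp_bot compl_antitone)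
  ultimately show ?thesis
    using set_meet_defined_Min_elts set_join_defined_Max_elts omp_operator_residuated[OF assms(2)]
      omp_idempotent omp_divisible omp_imp_bot by blast
qed

end
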